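(* Let $C$ be the constraint on the phase space $\mathcal{M}$, with flow $\alpha_C^t$. Let $f,T\in C^\infty(\mathcal{M})$ be two phase space functions and let $x\in\mathcal{M}$ be a phase space point such that $f(\alpha_C^t(x))=f(\alpha_C^s(x))$ for all $s,t\in\mathbb{R}$ for which $T(\alpha_C^t(x))=T(\alpha_C^s(x))$. Then $F_{[f,T]}(\tau,x)$ is invariant under the flow generated by $C$: for every $\tau$ in the range of $t\mapsto T(\alpha_C^t(x))$ and every $\varepsilon\in\mathbb{R}$, $F_{[f,T]}(\tau,\alpha_C^\varepsilon(x))$ is well defined and $$F_{[f,T]}(\tau,\alpha_C^\varepsilon(x))=F_{[f,T]}(\tau,x).$$
   Context: $\mathcal{M}$ is a finite-dimensional smooth manifold with a non-degenerate Poisson bracket $\{\cdot,\cdot\}$. For $C\in C^\infty(\mathcal{M})$ the Hamiltonian vector field $\chi_C$ is defined by $\chi_C(f)=\{C,f\}$, and $\alpha_C^t$ ($t\in\mathbb{R}$) denotes its flow, assumed to be defined for all $t\in\mathbb{R}$: $\frac{d}{dt}\alpha_C^t(x)=\chi_C(\alpha_C^t(x))$, $\alpha_C^0(x)=x$. The complete observable associated to $f,T$ is $$F_{[f,T]}(\tau,x):=f(\alpha_C^t(x))\big|_{T(\alpha_C^t(x))=\tau},$$ i.e. the value $f(\alpha_C^{t}(x))$ at any $t$ with $T(\alpha_C^{t}(x))=\tau$. It is well defined at $(\tau,x)$ if such a $t$ exists and the value does not depend on the choice of such $t$. *)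

theory Defs
  imports "HOL-Analysis.Analysis"
begin

section \<open>Smooth maps and smooth manifolds\<close>

text \<open>Both notions below are meant for open S: the derivatives are taken in the full
  neighbourhood filter. Asking every directional derivative to be of class k is, in finite
  dimensions, the same as asking the derivative itself to be of class k.\<close>

fun C_k_on :: "nat \<Rightarrow> 'a::euclidean_space set \<Rightarrow> ('a \<Rightarrow> 'b::real_normed_vector) \<Rightarrow> bool" where
  "C_k_on 0 S f \<longleftrightarrow> continuous_on S f"
| "C_k_on (Suc k) S f \<longleftrightarrow>
     (\<forall>x\<in>S. f differentiable (at x)) \<and>
     (\<forall>v. C_k_on k S (\<lambda>x. frechet_derivative f (at x) v))"

definition smooth_on :: "'a::euclidean_space set \<Rightarrow> ('a \<Rightarrow> 'b::real_normed_vector) \<Rightarrow> bool" where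
  "smooth_on S f \<longleftrightarrow> (\<forall>k. C_k_on k S f)"

text \<open>The manifold is the whole type 'm, whose topology is Hausdorff and second countable by its
  sort; the Euclidean space 'e is the model space. A chart is a pair of an open domain U and a
  coordinate map, of which only the values on U matter; its inverse is inv_into U. The atlas need
  not be maximal: it determines the smooth structure.\<close>

locale smooth_manifold =
  fixes atlas ::
    "('m::{t2_space,second_countable_topology} set \<times> ('m \<Rightarrow> 'e::euclidean_space)) set"
  assumes chart:
      "(U, \<phi>) \<in> atlas \<Longrightarrow>
         open U \<and> open (\<phi> ` U) \<and> homeomorphism U (\<phi> ` U) \<phi> (inv_into U \<phi>)"
    and covers: "(\<Union>(U, \<phi>)\<in>atlas. U) = UNIV"
    and compatible:
      "(U, \<phi>) \<in> atlas \<Longrightarrow> (V, \<psi>) \<in> atlas \<Longrightarrow>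
         smooth_on (\<phi> ` (U \<inter> V)) (\<psi> \<circ> inv_into U \<phi>)"

definition smooth_functions ::
    "('m set \<times> ('m \<Rightarrow> 'e::euclidean_space)) set \<Rightarrow> ('m \<Rightarrow> real) set" where
  "smooth_functions atlas =
     {f. \<forall>(U, \<phi>)\<in>atlas. smooth_on (\<phi> ` U) (f \<circ> inv_into U \<phi>)}"

definition differential_vanishes_at ::
    "('m set \<times> ('m \<Rightarrow> 'e::euclidean_space)) set \<Rightarrow> ('m \<Rightarrow> real) \<Rightarrow> 'm \<Rightarrow> bool" where
  "differential_vanishes_at atlas f x \<longleftrightarrow>
     (\<forall>(U, \<phi>)\<in>atlas. x \<in> U \<longrightarrow> (f \<circ> inv_into U \<phi> has_derivative (\<lambda>_. 0)) (at (\<phi> x)))"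

section \<open>Poisson brackets\<close>

text \<open>The values of the bracket on functions that are not smooth are irrelevant. Linearity and
  the Leibniz rule in the second argument follow by antisymmetry.\<close>

locale poisson_manifold = smooth_manifold atlas
  for atlas ::
    "('m::{t2_space,second_countable_topology} set \<times> ('m \<Rightarrow> 'e::euclidean_space)) set" +
  fixes bracket :: "('m \<Rightarrow> real) \<Rightarrow> ('m \<Rightarrow> real) \<Rightarrow> ('m \<Rightarrow> real)"
  assumes bracket_smooth:
      "f \<in> smooth_functions atlas \<Longrightarrow> g \<in> smooth_functions atlas \<Longrightarrow>
         bracket f g \<in> smooth_functions atlas"
    and bracket_add:
      "f \<in> smooth_functions atlas \<Longrightarrow> g \<in> smooth_functions atlas \<Longrightarrow>
       h \<in> smooth_functions atlas \<Longrightarrow>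
         bracket (\<lambda>x. f x + g x) h = (\<lambda>x. bracket f h x + bracket g h x)"
    and bracket_scale:
      "f \<in> smooth_functions atlas \<Longrightarrow> g \<in> smooth_functions atlas \<Longrightarrow>
         bracket (\<lambda>x. c * f x) g = (\<lambda>x. c * bracket f g x)"
    and bracket_antisym:
      "f \<in> smooth_functions atlas \<Longrightarrow> g \<in> smooth_functions atlas \<Longrightarrow>
         bracket f g = (\<lambda>x. - bracket g f x)"
    and bracket_Leibniz:
      "f \<in> smooth_functions atlas \<Longrightarrow> g \<in> smooth_functions atlas \<Longrightarrow>
       h \<in> smooth_functions atlas \<Longrightarrow>
         bracket (\<lambda>x. f x * g x) h = (\<lambda>x. f x * bracket g h x + bracket f h x * g x)"
    and bracket_Jacobi:
      "f \<in> smooth_functions atlas \<Longrightarrow> g \<in> smooth_functions atlas \<Longrightarrow>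
       h \<in> smooth_functions atlas \<Longrightarrow>
         bracket f (bracket g h) x + bracket g (bracket h f) x + bracket h (bracket f g) x = 0"

text \<open>Non-degeneracy: the map sending df at x to the tangent vector {f, -} at x, induced by the
  Poisson tensor, has trivial kernel; by equality of dimensions it is then an isomorphism from the
  cotangent to the tangent space.\<close>

locale nondegenerate_poisson_manifold = poisson_manifold atlas bracket
  for atlas ::
    "('m::{t2_space,second_countable_topology} set \<times> ('m \<Rightarrow> 'e::euclidean_space)) set"
    and bracket :: "('m \<Rightarrow> real) \<Rightarrow> ('m \<Rightarrow> real) \<Rightarrow> ('m \<Rightarrow> real)" +
  assumes nondegenerate:
      "f \<in> smooth_functions atlas \<Longrightarrow>
       (\<And>g. g \<in> smooth_functions atlas \<Longrightarrow> bracket f g x = 0) \<Longrightarrow>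
         differential_vanishes_at atlas f x"

section \<open>Hamiltonian flows\<close>

text \<open>Vector fields are derivations of the algebra of smooth functions; the tangent vector of such
  an X at x is the map sending g to X g x.\<close>

definition hamiltonian_vector_field ::
    "(('m \<Rightarrow> real) \<Rightarrow> ('m \<Rightarrow> real) \<Rightarrow> ('m \<Rightarrow> real)) \<Rightarrow> ('m \<Rightarrow> real) \<Rightarrow>
     (('m \<Rightarrow> real) \<Rightarrow> ('m \<Rightarrow> real))" where
  "hamiltonian_vector_field bracket C = (\<lambda>f. bracket C f)"

text \<open>The velocity of a curve c at time t is the tangent vector sending g to the derivative of
  g (c s) at s = t; the equation of an integral curve states that it equals X at c t.\<close>

definition integral_curve ::
    "('m set \<times> ('m \<Rightarrow> 'e::euclidean_space)) set \<Rightarrow> (('m \<Rightarrow> real) \<Rightarrow> ('m \<Rightarrow> real)) \<Rightarrow>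
     (real \<Rightarrow> 'm) \<Rightarrow> bool" where
  "integral_curve atlas X c \<longleftrightarrow>
     (\<forall>t. \<forall>g\<in>smooth_functions atlas.
        ((\<lambda>s. g (c s)) has_real_derivative X g (c t)) (at t))"

definition global_flow ::
    "('m set \<times> ('m \<Rightarrow> 'e::euclidean_space)) set \<Rightarrow> (('m \<Rightarrow> real) \<Rightarrow> ('m \<Rightarrow> real)) \<Rightarrow>
     (real \<Rightarrow> 'm \<Rightarrow> 'm) \<Rightarrow> bool" where
  "global_flow atlas X \<alpha> \<longleftrightarrow>
     (\<forall>x. \<alpha> 0 x = x \<and> integral_curve atlas X (\<lambda>t. \<alpha> t x))"

section \<open>Complete observables\<close>

definition complete_observable_well_defined ::
    "(real \<Rightarrow> 'm \<Rightarrow> 'm) \<Rightarrow> ('m \<Rightarrow> real) \<Rightarrow> ('m \<Rightarrow> real) \<Rightarrow> real \<Rightarrow> 'm \<Rightarrow> bool" where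
  "complete_observable_well_defined \<alpha> f T \<tau> x \<longleftrightarrow>
     (\<exists>t. T (\<alpha> t x) = \<tau>) \<and>
     (\<forall>s t. T (\<alpha> s x) = \<tau> \<longrightarrow> T (\<alpha> t x) = \<tau> \<longrightarrow> f (\<alpha> s x) = f (\<alpha> t x))"

text \<open>The value is only meaningful where the complete observable is well defined.\<close>

definition complete_observable ::
    "(real \<Rightarrow> 'm \<Rightarrow> 'm) \<Rightarrow> ('m \<Rightarrow> real) \<Rightarrow> ('m \<Rightarrow> real) \<Rightarrow> real \<Rightarrow> 'm \<Rightarrow> real" where
  "complete_observable \<alpha> f T \<tau> x = (THE v. \<exists>t. T (\<alpha> t x) = \<tau> \<and> v = f (\<alpha> t x))"

end

theory Submission
  imports Defs
begin

text \<open>Since \<open>\<alpha> s (\<alpha> \<epsilon> x) = \<alpha> (s + \<epsilon>) x\<close>, replacing \<open>x\<close> by \<open>\<alpha> \<epsilon> x\<close> only reparametrises the orbit over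
  which the complete observable is evaluated. The group law is uniqueness of integral curves. No
  coordinate expression of the vector field X is needed for it: if g is a smooth function that
  agrees with a coordinate near a point, then X g is smooth, hence locally Lipschitz in the
  chart, and Gronwall's inequality applies to the coordinates of two integral curves.\<close>

section \<open>Calculus of C^k maps\<close>

lemma frechet_derivative_cong_open:
  assumes "open S" "x \<in> S" "\<And>y. y \<in> S \<Longrightarrow> f y = g y"
  shows "frechet_derivative f (at x) = frechet_derivative g (at x)"
proof -
  have "(f has_derivative D) (at x) \<longleftrightarrow> (g has_derivative D) (at x)" for D
    using has_derivative_transform_within_open[OF _ assms(1,2), of f D UNIV g]
      has_derivative_transform_within_open[OF _ assms(1,2), of g D UNIV f] assms(3)
    by auto
  then show ?thesis
    by (simp add: frechet_derivative_def)
qed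

text \<open>Derivatives are taken in the full neighbourhood filter, so openness of \<open>S\<close>
  is what carries agreement of the functions over to their derivatives.\<close>

lemma C_k_on_cong:
  assumes "open S" "\<And>x. x \<in> S \<Longrightarrow> f x = g x"
  shows "C_k_on k S f \<longleftrightarrow> C_k_on k S g"
  using assms(2)
proof (induction k arbitrary: f g)
  case 0
  then show ?case
    by (auto intro: continuous_on_cong[THEN iffD1])
next
  case (Suc k)
  have "f differentiable (at x) \<longleftrightarrow> g differentiable (at x)" if "x \<in> S" for x
    using has_derivative_transform_within_open[OF _ assms(1) that, of f _ UNIV g]
      has_derivative_transform_within_open[OF _ assms(1) that, of g _ UNIV f] Suc.prems
    unfolding differentiable_def by metis
  moreover have "C_k_on k S (\<lambda>x. frechet_derivative f (at x) v) \<longleftrightarrow>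
      C_k_on k S (\<lambda>x. frechet_derivative g (at x) v)" for v
    by (rule Suc.IH) (simp add: frechet_derivative_cong_open[OF assms(1) _ Suc.prems])
  ultimately show ?case
    by simp
qed

text \<open>Allows an explicit formula \<open>D\<close> to stand in for
  \<open>frechet_derivative\<close>; by uniqueness of the derivative the two agree on the open set
  \<open>S\<close>.\<close>

lemma C_k_on_SucI:
  assumes "open S" "\<And>x. x \<in> S \<Longrightarrow> (f has_derivative D x) (at x)"
    and "\<And>v. C_k_on k S (\<lambda>x. D x v)"
  shows "C_k_on (Suc k) S f"
proof -
  have "C_k_on k S (\<lambda>x. frechet_derivative f (at x) v) \<longleftrightarrow> C_k_on k S (\<lambda>x. D x v)" for v
    by (rule C_k_on_cong[OF assms(1)]) (simp add: frechet_derivative_at[OF assms(2), symmetric])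
  then show ?thesis
    using assms by (auto simp: differentiable_def)
qed

lemma C_k_on_SucD:
  assumes "C_k_on (Suc k) S f"
  shows "C_k_on k S f"
  using assms
proof (induction k arbitrary: f)
  case 0
  then show ?case
    by (auto intro!: continuous_at_imp_continuous_on differentiable_imp_continuous_within)
next
  case (Suc k)
  then show ?case
    by (metis C_k_on.simps(2))
qed

lemma C_k_on_subset:
  assumes "C_k_on k S f" "T \<subseteq> S"
  shows "C_k_on k T f"
  using assms by (induction k arbitrary: f) (auto intro: continuous_on_subset)

lemma C_k_on_Un:
  assumes "C_k_on k S f" "C_k_on k T f" "open S" "open T"
  shows "C_k_on k (S \<union> T) f"
  using assms by (induction k arbitrary: f) (auto intro: continuous_on_open_Un)

lemma C_k_on_const:
  assumes "open S"
  shows "C_k_on k S (\<lambda>x. c)"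
proof (induction k arbitrary: c)
  case (Suc k)
  show ?case
    by (rule C_k_on_SucI[OF assms, where D = "\<lambda>_ _. 0"]) (auto intro: Suc)
qed simp

lemma C_k_on_ident:
  assumes "open S"
  shows "C_k_on k S (\<lambda>x. x)"
proof (cases k)
  case (Suc j)
  show ?thesis
    unfolding Suc
    by (rule C_k_on_SucI[OF assms, where D = "\<lambda>_ v. v"]) (auto intro: C_k_on_const assms)
qed simp

lemma C_k_on_add:
  assumes "open S" "C_k_on k S f" "C_k_on k S g"
  shows "C_k_on k S (\<lambda>x. f x + g x)"
  using assms(2,3)
proof (induction k arbitrary: f g)
  case 0
  then show ?case
    by (auto intro: continuous_intros)
next
  case (Suc k)
  show ?case
    by (rule C_k_on_SucI[OF assms(1), where
          D = "\<lambda>x v. frechet_derivative f (at x) v + frechet_derivative g (at x) v"])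
      (use Suc in \<open>auto intro: has_derivative_add simp flip: frechet_derivative_works\<close>)
qed

lemma C_k_on_sum:
  assumes "open S" "\<And>i. i \<in> I \<Longrightarrow> C_k_on k S (f i)"
  shows "C_k_on k S (\<lambda>x. \<Sum>i\<in>I. f i x)"
  using assms(2)
  by (induction I rule: infinite_finite_induct)
    (auto intro: C_k_on_add C_k_on_const assms(1))

text \<open>By the product rule the derivative is a sum of two terms of the same shape, with one
  factor differentiated, so induction over arbitrary \<open>f\<close> and \<open>g\<close>
  closes.\<close>

lemma C_k_on_bounded_bilinear:
  assumes "bounded_bilinear B" "open S" "C_k_on k S f" "C_k_on k S g"
  shows "C_k_on k S (\<lambda>x. B (f x) (g x))"
  using assms(3,4)
proof (induction k arbitrary: f g)
  case 0
  then show ?case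
    by (auto intro: bounded_bilinear.continuous_on[OF assms(1)])
next
  case (Suc k)
  show ?case
  proof (rule C_k_on_SucI[OF assms(2)])
    show "((\<lambda>x. B (f x) (g x)) has_derivative
        (\<lambda>v. B (f x) (frechet_derivative g (at x) v) + B (frechet_derivative f (at x) v) (g x)))
          (at x)" if "x \<in> S" for x
      using Suc.prems that
      by (auto intro!: bounded_bilinear.FDERIV[OF assms(1)] simp flip: frechet_derivative_works)
    show "C_k_on k S (\<lambda>x. B (f x) (frechet_derivative g (at x) v) +
        B (frechet_derivative f (at x) v) (g x))" for v
      using Suc.prems C_k_on_SucD[OF Suc.prems(1)] C_k_on_SucD[OF Suc.prems(2)]
      by (intro C_k_on_add assms(2) Suc.IH) auto
  qed
qed

lemmas C_k_on_mult = C_k_on_bounded_bilinear[OF bounded_bilinear_mult]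
lemmas C_k_on_scaleR = C_k_on_bounded_bilinear[OF bounded_bilinear_scaleR]
lemmas C_k_on_inner = C_k_on_bounded_bilinear[OF bounded_bilinear_inner]

lemma C_k_on_diff:
  fixes f g :: "'a::euclidean_space \<Rightarrow> 'b::real_normed_vector"
  assumes "open S" "C_k_on k S f" "C_k_on k S g"
  shows "C_k_on k S (\<lambda>x. f x - g x)"
  using C_k_on_add[OF assms(1,2)
      C_k_on_scaleR[OF assms(1) C_k_on_const[OF assms(1), of k "-1"] assms(3)]]
  by simp

lemma C_k_on_compose:
  fixes f :: "'a::euclidean_space \<Rightarrow> 'b::euclidean_space"
  assumes "open S" "open T" "f ` S \<subseteq> T" "C_k_on k S f" "C_k_on k T g"
  shows "C_k_on k S (\<lambda>x. g (f x))"
  using assms(4,5)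
proof (induction k arbitrary: g)
  case 0
  then show ?case
    using assms(3) by (auto intro: continuous_on_compose2)
next
  case (Suc k)
  let ?Df = "\<lambda>x. frechet_derivative f (at x)" and ?Dg = "\<lambda>y. frechet_derivative g (at y)"
  have Df: "(f has_derivative ?Df x) (at x)" and Dg: "(g has_derivative ?Dg (f x)) (at (f x))"
    if "x \<in> S" for x
    using Suc.prems that assms(3) by (auto simp flip: frechet_derivative_works)
  show ?case
  proof (rule C_k_on_SucI[OF assms(1)])
    fix x assume x: "x \<in> S"
    have lin: "linear (?Dg (f x))"
      using Dg[OF x] by (rule has_derivative_linear)
    \<comment> \<open>In the chain rule both base point and direction vary with \<open>x\<close>.
      Expanding in a basis leaves only fixed directions \<open>b\<close>, and the induction
      hypothesis applies to each directional derivative of \<open>g\<close>.\<close>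
    have "?Dg (f x) (?Df x v) = (\<Sum>b\<in>Basis. (?Df x v \<bullet> b) *\<^sub>R ?Dg (f x) b)" for v
      by (subst euclidean_representation[of "?Df x v", symmetric])
        (simp add: linear_sum[OF lin] linear_scale[OF lin])
    then show "((\<lambda>x. g (f x)) has_derivative
        (\<lambda>v. \<Sum>b\<in>Basis. (?Df x v \<bullet> b) *\<^sub>R ?Dg (f x) b)) (at x)"
      using has_derivative_compose[OF Df[OF x] Dg[OF x]] by simp
  next
    have "C_k_on k S (\<lambda>x. ?Dg (f x) b)" for b
      using Suc.prems C_k_on_SucD[OF Suc.prems(1)] by (intro Suc.IH) auto
    then show "C_k_on k S (\<lambda>x. \<Sum>b\<in>Basis. (?Df x v \<bullet> b) *\<^sub>R ?Dg (f x) b)" for v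
      using Suc.prems
      by (intro C_k_on_sum C_k_on_scaleR C_k_on_inner C_k_on_const assms(1)) auto
  qed
qed

lemma C_k_on_inverse:
  fixes f :: "'a::euclidean_space \<Rightarrow> real"
  assumes "open S" "\<And>x. x \<in> S \<Longrightarrow> f x \<noteq> 0" "C_k_on k S f"
  shows "C_k_on k S (\<lambda>x. inverse (f x))"
  using assms(3)
proof (induction k)
  case 0
  then show ?case
    using assms(2) by (auto intro: continuous_intros)
next
  case (Suc k)
  let ?Df = "\<lambda>x. frechet_derivative f (at x)"
  have IH: "C_k_on k S (\<lambda>x. inverse (f x))"
    using Suc C_k_on_SucD by blast
  show ?case
  proof (rule C_k_on_SucI[OF assms(1)])
    \<comment> \<open>The derivative involves \<open>f\<close> only through
      \<open>inverse (f x)\<close> and \<open>?Df\<close>; the first is of class \<open>k\<close> by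
      induction, the second by assumption.\<close>
    show "((\<lambda>x. inverse (f x)) has_derivative
        (\<lambda>v. - 1 * (inverse (f x) * ?Df x v * inverse (f x)))) (at x)" if "x \<in> S" for x
      using Deriv.has_derivative_inverse[of f x "?Df x" UNIV] assms(2)[OF that] Suc.prems that
      by (auto simp flip: frechet_derivative_works)
    show "C_k_on k S (\<lambda>x. - 1 * (inverse (f x) * ?Df x v * inverse (f x)))" for v
      using Suc.prems by (intro C_k_on_mult C_k_on_const assms(1) IH) auto
  qed
qed

section \<open>Plateau functions\<close>

text \<open>The family is closed under differentiation up to linear combinations, which makes
  induction on the order of differentiability work.\<close>

definition flat_exp :: "nat \<Rightarrow> real \<Rightarrow> real" where
  "flat_exp n t = (if t > 0 then inverse t ^ n * exp (- inverse t) else 0)"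

text \<open>From the right, substitute the inverse of \<open>t\<close>: the exponential beats every
  power at infinity. From the left the function is zero.\<close>

lemma flat_exp_tendsto_0: "(flat_exp n \<longlongrightarrow> 0) (at 0)"
proof -
  have "((\<lambda>x::real. x ^ n * exp (- x)) \<longlongrightarrow> 0) at_top"
    using tendsto_power_div_exp_0[of n] by (simp add: exp_minus divide_inverse)
  then have "((\<lambda>t::real. (inverse t) ^ n * exp (- inverse t)) \<longlongrightarrow> 0) (at_right 0)"
    by (rule filterlim_compose[OF _ filterlim_inverse_at_top_right])
  then have "(flat_exp n \<longlongrightarrow> 0) (at_right 0)"
    by (rule Lim_transform_eventually)
      (auto simp: eventually_at_filter flat_exp_def)
  moreover have "(flat_exp n \<longlongrightarrow> 0) (at_left 0)"
    by (rule Lim_transform_eventually[OF tendsto_const])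
      (auto simp: eventually_at_filter flat_exp_def)
  ultimately show ?thesis
    by (simp add: filterlim_split_at)
qed

lemma flat_exp_has_derivative:
  "(flat_exp n has_real_derivative flat_exp (n + 2) t - real n * flat_exp (n + 1) t) (at t)"
proof -
  consider "t > 0" | "t < 0" | "t = 0"
    by linarith
  then show ?thesis
  proof cases
    case 1
    have "((\<lambda>t. inverse t ^ n * exp (- inverse t)) has_real_derivative
        real n * (- (inverse t * 1 * inverse t) * inverse t ^ (n - Suc 0)) * exp (- inverse t) +
        exp (- inverse t) * - (- (inverse t * 1 * inverse t)) * inverse t ^ n) (at t)"
      using 1
      by (intro DERIV_mult DERIV_power DERIV_inverse' DERIV_ident DERIV_minus DERIV_fun_exp) auto
    also have "real n * (- (inverse t * 1 * inverse t) * inverse t ^ (n - Suc 0)) *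
        exp (- inverse t) + exp (- inverse t) * - (- (inverse t * 1 * inverse t)) * inverse t ^ n =
        flat_exp (n + 2) t - real n * flat_exp (n + 1) t"
      \<comment> \<open>For \<open>n = 0\<close> the truncated exponent \<open>n - Suc 0\<close> is
        harmless, since the factor \<open>real n\<close> vanishes.\<close>
      using 1 by (cases n) (simp_all add: flat_exp_def algebra_simps)
    finally show ?thesis
      by (rule has_field_derivative_transform_within_open[where S = "{0<..}"])
        (use 1 in \<open>auto simp: flat_exp_def\<close>)
  next
    case 2
    have "((\<lambda>t. 0) has_real_derivative flat_exp (n + 2) t - real n * flat_exp (n + 1) t) (at t)"
      using 2 by (simp add: flat_exp_def)
    then show ?thesis
      by (rule has_field_derivative_transform_within_open[where S = "{..<0}"])
        (use 2 in \<open>auto simp: flat_exp_def\<close>)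
  next
    case 3
    \<comment> \<open>Away from 0 this difference quotient is
      \<open>flat_exp (Suc n)\<close>.\<close>
    have "((\<lambda>s. (flat_exp n s - flat_exp n 0) / (s - 0)) \<longlongrightarrow> 0) (at 0)"
      by (rule Lim_transform_eventually[OF flat_exp_tendsto_0[of "Suc n"]])
        (auto simp: eventually_at_filter flat_exp_def divide_inverse)
    then show ?thesis
      using 3 by (simp add: has_field_derivative_iff flat_exp_def)
  qed
qed

lemma C_k_on_flat_exp: "C_k_on k UNIV (flat_exp n)"
proof (induction k arbitrary: n)
  case 0
  then show ?case
    using flat_exp_has_derivative
    by (auto intro!: continuous_at_imp_continuous_on DERIV_isCont)
next
  case (Suc k)
  show ?case
  proof (rule C_k_on_SucI)
    show "(flat_exp n has_derivative
        (\<lambda>v. (flat_exp (n + 2) t - real n * flat_exp (n + 1) t) * v)) (at t)" for t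
      using flat_exp_has_derivative by (simp add: has_field_derivative_def)
    show "C_k_on k UNIV (\<lambda>t. (flat_exp (n + 2) t - real n * flat_exp (n + 1) t) * v)" for v
      by (intro C_k_on_mult C_k_on_diff C_k_on_const Suc) auto
  qed simp
qed

definition smooth_step :: "real \<Rightarrow> real" where
  "smooth_step t = flat_exp 0 t * inverse (flat_exp 0 t + flat_exp 0 (1 - t))"

lemma smooth_step_eq_0: "t \<le> 0 \<Longrightarrow> smooth_step t = 0"
  by (simp add: smooth_step_def flat_exp_def)

lemma smooth_step_eq_1: "t \<ge> 1 \<Longrightarrow> smooth_step t = 1"
  by (simp add: smooth_step_def flat_exp_def)

lemma C_k_on_smooth_step: "C_k_on k UNIV smooth_step"
proof -
  have "C_k_on k UNIV (\<lambda>t. flat_exp 0 (1 - t))"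
    by (rule C_k_on_compose[where T = UNIV and f = "\<lambda>t. 1 - t"])
      (rule C_k_on_diff C_k_on_const C_k_on_ident C_k_on_flat_exp open_UNIV subset_UNIV)+
  \<comment> \<open>At least one of \<open>t\<close> and \<open>1 - t\<close> is positive, so one
    summand is positive and the other nonnegative.\<close>
  moreover have "flat_exp 0 t + flat_exp 0 (1 - t) \<noteq> 0" for t
    by (auto simp: flat_exp_def add_pos_pos less_imp_neq[symmetric])
  ultimately show ?thesis
    unfolding smooth_step_def[abs_def]
    by (intro C_k_on_mult C_k_on_inverse C_k_on_add C_k_on_flat_exp) auto
qed

text \<open>The squared distance keeps the function smooth at the centre \<open>p\<close>. For
  \<open>r > 0\<close> the argument of \<open>smooth_step\<close> is at least 1 up to distance
  \<open>r\<close> and at most 0 from distance sqrt 2 times \<open>r\<close> on;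
  \<open>2 * r\<close> serves as a convenient support radius.\<close>

definition plateau :: "'a::euclidean_space \<Rightarrow> real \<Rightarrow> 'a \<Rightarrow> real" where
  "plateau p r y = smooth_step (2 - ((y - p) \<bullet> (y - p)) * inverse (r\<^sup>2))"

lemma C_k_on_plateau: "C_k_on k UNIV (plateau p r)"
  unfolding plateau_def[abs_def]
  by (rule C_k_on_compose[where T = UNIV and g = smooth_step and
        f = "\<lambda>y. 2 - ((y - p) \<bullet> (y - p)) * inverse (r\<^sup>2)"])
    (rule C_k_on_diff C_k_on_mult C_k_on_inner C_k_on_const C_k_on_ident C_k_on_smooth_step
      open_UNIV subset_UNIV)+

lemma plateau_eq_1:
  assumes "r > 0" "y \<in> cball p r"
  shows "plateau p r y = 1"
proof -
  have "(norm (y - p))\<^sup>2 \<le> r\<^sup>2"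
    using assms by (intro power_mono) (auto simp: dist_norm norm_minus_commute)
  then show ?thesis
    unfolding plateau_def using assms(1)
    by (intro smooth_step_eq_1) (simp add: dot_square_norm field_simps)
qed

lemma plateau_eq_0:
  assumes "r > 0" "y \<notin> cball p (2 * r)"
  shows "plateau p r y = 0"
proof -
  have "(2 * r)\<^sup>2 \<le> (norm (y - p))\<^sup>2"
    using assms by (intro power_mono) (auto simp: dist_norm norm_minus_commute)
  then have "2 * r\<^sup>2 \<le> (norm (y - p))\<^sup>2"
    using zero_le_power2[of r] unfolding four_x_squared[symmetric] by linarith
  then show ?thesis
    unfolding plateau_def using assms(1)
    by (intro smooth_step_eq_0) (simp add: dot_square_norm field_simps)
qed

section \<open>Lipschitz and Gronwall estimates\<close>

text \<open>The partial derivatives are bounded on the compact ball, hence so is the operator norm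
  of the derivative; the ball is convex, so the mean value inequality applies.\<close>

lemma C_k_on_1_imp_lipschitz_cball:
  fixes f :: "'a::euclidean_space \<Rightarrow> real"
  assumes "C_k_on 1 S f" "cball p r \<subseteq> S"
  obtains L where "L \<ge> 0"
    "\<And>y z. y \<in> cball p r \<Longrightarrow> z \<in> cball p r \<Longrightarrow> \<bar>f y - f z\<bar> \<le> L * norm (y - z)"
proof -
  let ?D = "\<lambda>x. frechet_derivative f (at x)"
  have D: "(f has_derivative ?D x) (at x)" if "x \<in> S" for x
    using assms(1) that by (auto simp flip: frechet_derivative_works)
  \<comment> \<open>\<open>C_k_on\<close> gives continuity of the derivative only in each fixed
    direction; the sum over the basis dominates the operator norm and is continuous.\<close>
  have "continuous_on S (\<lambda>x. \<Sum>b\<in>Basis. \<bar>?D x b\<bar>)"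
    using assms(1) by (intro continuous_on_sum continuous_on_rabs) auto
  then have "compact ((\<lambda>x. \<Sum>b\<in>Basis. \<bar>?D x b\<bar>) ` cball p r)"
    using assms(2) by (intro compact_continuous_image) (auto intro: continuous_on_subset)
  then obtain L where L: "\<And>x. x \<in> cball p r \<Longrightarrow> norm (\<Sum>b\<in>Basis. \<bar>?D x b\<bar>) \<le> L" and "L > 0"
    by (force dest!: compact_imp_bounded simp: bounded_pos)
  have onorm: "onorm (?D x) \<le> L" if x: "x \<in> cball p r" for x
  proof (rule onorm_le)
    fix v
    have lin: "linear (?D x)"
      using D x assms(2) by (blast intro: has_derivative_linear)
    have "?D x v = (\<Sum>b\<in>Basis. (v \<bullet> b) * ?D x b)"
      by (subst euclidean_representation[of v, symmetric])
        (simp add: linear_sum[OF lin] linear_scale[OF lin])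
    then have "norm (?D x v) \<le> (\<Sum>b\<in>Basis. norm ((v \<bullet> b) * ?D x b))"
      using norm_sum by metis
    also have "\<dots> \<le> (\<Sum>b\<in>Basis. norm v * \<bar>?D x b\<bar>)"
      by (intro sum_mono) (auto simp: abs_mult Basis_le_norm intro: mult_right_mono)
    also have "\<dots> \<le> L * norm v"
      using mult_left_mono[OF L[OF x] norm_ge_zero[of v]]
      by (simp add: mult.commute flip: sum_distrib_left)
    finally show "norm (?D x v) \<le> L * norm v" .
  qed
  have "norm (f y - f z) \<le> L * norm (y - z)" if "y \<in> cball p r" "z \<in> cball p r" for y z
    using that onorm assms(2)
    by (intro differentiable_bound[of "cball p r" f ?D])
      (auto intro!: has_derivative_at_withinI D)
  with \<open>L > 0\<close> show ?thesis
    by (intro that[of L]) auto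
qed

text \<open>To the right of \<open>a\<close> the product of \<open>u\<close> with
  \<open>exp (- K * t)\<close> does not increase, to the left the product with
  \<open>exp (K * t)\<close> does not decrease. Both vanish at \<open>a\<close>, so \<open>u\<close>
  is nonpositive on either side.\<close>

lemma gronwall_zero:
  fixes u u' :: "real \<Rightarrow> real"
  assumes "e > 0" and deriv: "\<And>t. \<bar>t - a\<bar> < e \<Longrightarrow> (u has_real_derivative u' t) (at t)"
    and bound: "\<And>t. \<bar>t - a\<bar> < e \<Longrightarrow> \<bar>u' t\<bar> \<le> K * u t"
    and nonneg: "\<And>t. \<bar>t - a\<bar> < e \<Longrightarrow> u t \<ge> 0" and "u a = 0" and t: "\<bar>t - a\<bar> < e"
  shows "u t = 0"
proof -
  have "u t \<le> 0"
  proof (cases "a \<le> t")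
    case True
    have "u t * exp (- K * t) \<le> u a * exp (- K * a)"
    proof (rule DERIV_nonpos_imp_nonincreasing[OF True, of "\<lambda>s. u s * exp (- K * s)"])
      fix s assume s: "a \<le> s" "s \<le> t"
      then have "\<bar>s - a\<bar> < e"
        using t by auto
      then have "((\<lambda>s. u s * exp (- K * s)) has_real_derivative
          (u' s - K * u s) * exp (- K * s)) (at s)" "u' s - K * u s \<le> 0"
        using deriv bound by (auto intro!: derivative_eq_intros simp: algebra_simps dest: abs_le_D1)
      then show "\<exists>y. ((\<lambda>s. u s * exp (- K * s)) has_real_derivative y) (at s) \<and> y \<le> 0"
        by (blast intro: mult_nonpos_nonneg exp_ge_zero)
    qed
    with \<open>u a = 0\<close> show ?thesis
      by (simp add: mult_le_0_iff not_le)
  next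
    case False
    then have "t \<le> a"
      by simp
    have "u t * exp (K * t) \<le> u a * exp (K * a)"
    proof (rule DERIV_nonneg_imp_nondecreasing[OF \<open>t \<le> a\<close>, of "\<lambda>s. u s * exp (K * s)"])
      fix s assume s: "t \<le> s" "s \<le> a"
      then have "\<bar>s - a\<bar> < e"
        using t by auto
      then have "((\<lambda>s. u s * exp (K * s)) has_real_derivative
          (u' s + K * u s) * exp (K * s)) (at s)" "u' s + K * u s \<ge> 0"
        using deriv bound[of s] by (auto intro!: derivative_eq_intros simp: algebra_simps)
      then show "\<exists>y. ((\<lambda>s. u s * exp (K * s)) has_real_derivative y) (at s) \<and> y \<ge> 0"
        by (blast intro: mult_nonneg_nonneg exp_ge_zero)
    qed
    with \<open>u a = 0\<close> show ?thesis
      by (simp add: mult_le_0_iff not_le)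
  qed
  with nonneg[OF t] show ?thesis
    by simp
qed

section \<open>Uniqueness of integral curves\<close>

context smooth_manifold
begin

section \<open>Charts and extension of functions by zero\<close>

lemma chart_image_open:
  assumes "(U, \<phi>) \<in> atlas" "open W" "W \<subseteq> U"
  shows "open (\<phi> ` W)"
proof -
  have "openin (top_of_set U) W"
    using assms by (simp add: openin_open_eq chart)
  then have "openin (top_of_set (\<phi> ` U)) (\<phi> ` W)"
    using chart[OF assms(1)] homeomorphism_imp_open_map by blast
  then show ?thesis
    using chart[OF assms(1)] openin_open_eq by blast
qed

lemma chart_inj_on:
  assumes "(U, \<phi>) \<in> atlas"
  shows "inj_on \<phi> U"
proof (rule inj_on_inverseI)
  show "inv_into U \<phi> (\<phi> x) = x" if "x \<in> U" for x
    using chart[OF assms] that by (auto intro: homeomorphism_apply1)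
qed

lemma obtain_chart:
  obtains U \<phi> where "(U, \<phi>) \<in> atlas" "x \<in> U"
proof -
  have "x \<in> (\<Union>(U, \<phi>)\<in>atlas. U)"
    by (simp only: covers UNIV_I)
  then show ?thesis
    using that by auto
qed

text \<open>The support condition is what makes the extension by zero smooth: the compact set pulled
  back to the manifold is closed because the manifold is Hausdorff.\<close>

lemma extension_by_zero_smooth:
  assumes U: "(U, \<phi>) \<in> atlas" and h: "\<And>k. C_k_on k UNIV h"
    and K: "compact K" "K \<subseteq> \<phi> ` U" "\<And>y. y \<notin> K \<Longrightarrow> h y = 0"
  shows "(\<lambda>q. if q \<in> U then h (\<phi> q) else 0) \<in> smooth_functions atlas"
proof -
  let ?g = "\<lambda>q. if q \<in> U then h (\<phi> q) else 0"
  let ?K = "inv_into U \<phi> ` K"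
  have "continuous_on (\<phi> ` U) (inv_into U \<phi>)"
    using chart[OF U] by (auto simp: homeomorphism_def)
  then have "closed ?K"
    using K by (intro compact_imp_closed compact_continuous_image) (auto intro: continuous_on_subset)
  have "?K \<subseteq> U"
    using K(2) by (auto intro: inv_into_into)
  have g0: "?g q = 0" if "q \<notin> ?K" for q
    using that K(3)[of "\<phi> q"] inv_into_f_f[OF chart_inj_on[OF U]] by (metis imageI)
  have "C_k_on k (\<psi> ` V) (?g \<circ> inv_into V \<psi>)" if V: "(V, \<psi>) \<in> atlas" for V \<psi> k
  proof -
    \<comment> \<open>Two open pieces cover the image of \<open>V\<close>: on \<open>?S\<close> the
      function is \<open>h\<close> after a transition map, on \<open>?T\<close> it is zero.\<close>
    let ?S = "\<psi> ` (V \<inter> U)" and ?T = "\<psi> ` (V - ?K)"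
    have inv: "inv_into V \<psi> (\<psi> q) = q" if "q \<in> V" for q
      using inv_into_f_f[OF chart_inj_on[OF V] that] .
    have "open ?S"
      using chart[OF U] chart[OF V] by (intro chart_image_open[OF V]) auto
    have "open ?T"
      using \<open>closed ?K\<close> chart[OF V] by (intro chart_image_open[OF V]) auto
    have "C_k_on k ?S (\<lambda>y. h ((\<phi> \<circ> inv_into V \<psi>) y))"
      using compatible[OF V U] h
      by (intro C_k_on_compose[where f = "\<phi> \<circ> inv_into V \<psi>" and g = h,
            OF \<open>open ?S\<close> open_UNIV subset_UNIV])
        (simp_all only: smooth_on_def)
    moreover have "h ((\<phi> \<circ> inv_into V \<psi>) y) = (?g \<circ> inv_into V \<psi>) y" if "y \<in> ?S" for y
      using that inv by auto
    ultimately have 1: "C_k_on k ?S (?g \<circ> inv_into V \<psi>)"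
      by (rule C_k_on_cong[OF \<open>open ?S\<close>, THEN iffD1, rotated])
    have "0 = (?g \<circ> inv_into V \<psi>) y" if y: "y \<in> ?T" for y
    proof -
      obtain q where q: "q \<in> V" "q \<notin> ?K" "y = \<psi> q"
        using y by blast
      show ?thesis
        unfolding q(3) comp_apply inv[OF q(1)] g0[OF q(2)] ..
    qed
    then have 2: "C_k_on k ?T (?g \<circ> inv_into V \<psi>)"
      by (rule C_k_on_cong[OF \<open>open ?T\<close>, THEN iffD1, OF _ C_k_on_const[OF \<open>open ?T\<close>]])
    have "V = (V \<inter> U) \<union> (V - ?K)"
      using \<open>?K \<subseteq> U\<close> by blast
    then have "\<psi> ` V = ?S \<union> ?T"
      by (metis image_Un)
    then show ?thesis
      using C_k_on_Un[OF 1 2 \<open>open ?S\<close> \<open>open ?T\<close>] by metis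
  qed
  then show ?thesis
    unfolding smooth_functions_def smooth_on_def by blast
qed

lemma integral_curveD:
  assumes "integral_curve atlas X c" "g \<in> smooth_functions atlas"
  shows "((\<lambda>s. g (c s)) has_real_derivative X g (c t)) (at t)"
  using assms by (simp add: integral_curve_def)

text \<open>The definition of an integral curve only speaks of smooth functions along the curve;
  bump functions recover continuity for the topology of the manifold.\<close>

lemma integral_curve_continuous:
  assumes c: "integral_curve atlas X c"
  shows "continuous_on UNIV c"
proof (rule continuous_at_imp_continuous_on, rule ballI)
  fix t
  have "\<forall>\<^sub>F s in at t. c s \<in> W" if W: "open W" "c t \<in> W" for W
  proof -
    obtain U \<phi> where U: "(U, \<phi>) \<in> atlas" "c t \<in> U"
      by (rule obtain_chart)
    have "open (\<phi> ` (U \<inter> W))"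
      using chart[OF U(1)] W by (intro chart_image_open[OF U(1)]) auto
    then obtain R where R: "R > 0" "cball (\<phi> (c t)) R \<subseteq> \<phi> ` (U \<inter> W)"
      using U W unfolding open_contains_cball by blast
    \<comment> \<open>The radius \<open>R / 2\<close> makes the bump vanish outside the ball of
      radius \<open>R\<close>, which lies in the image of \<open>U \<inter> W\<close>. Positivity
      along the curve therefore forces the curve into \<open>W\<close>.\<close>
    let ?h = "plateau (\<phi> (c t)) (R / 2)"
    let ?g = "\<lambda>q. if q \<in> U then ?h (\<phi> q) else 0"
    have zero: "?h y = 0" if "y \<notin> cball (\<phi> (c t)) R" for y
      using plateau_eq_0[of "R / 2" y] that R by simp
    have "?g \<in> smooth_functions atlas"
      using R zero by (intro extension_by_zero_smooth[OF U(1) C_k_on_plateau compact_cball]) blast+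
    from integral_curveD[OF c this] have "((\<lambda>s. ?g (c s)) \<longlongrightarrow> ?g (c t)) (at t)"
      using DERIV_isCont isCont_def by blast
    moreover have "?g (c t) > 0"
      using U R plateau_eq_1[of "R / 2" "\<phi> (c t)"] by simp
    ultimately have "\<forall>\<^sub>F s in at t. ?g (c s) > 0"
      by (rule order_tendstoD)
    then show ?thesis
    proof (rule eventually_mono)
      fix s assume pos: "?g (c s) > 0"
      then have "c s \<in> U" "\<phi> (c s) \<in> cball (\<phi> (c t)) R"
        using zero[of "\<phi> (c s)"] by (auto split: if_splits)
      then obtain q where "q \<in> U" "q \<in> W" "\<phi> (c s) = \<phi> q"
        using R(2) by blast
      with \<open>c s \<in> U\<close> show "c s \<in> W"
        using inj_onD[OF chart_inj_on[OF U(1)]] by metis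
    qed
  qed
  then show "isCont c t"
    unfolding isCont_def tendsto_def by blast
qed

text \<open>Locally the curves are compared through the coordinates multiplied by a plateau function,
  which are globally smooth, so that the equation of an integral curve applies to them.\<close>

lemma integral_curve_unique_local:
  assumes X: "\<And>g. g \<in> smooth_functions atlas \<Longrightarrow> X g \<in> smooth_functions atlas"
    and c: "integral_curve atlas X c" and d: "integral_curve atlas X d" and eq: "c a = d a"
  shows "\<forall>\<^sub>F t in nhds a. c t = d t"
proof -
  obtain U \<phi> where U: "(U, \<phi>) \<in> atlas" "c a \<in> U"
    by (rule obtain_chart)
  have open_image: "open (\<phi> ` U)"
    using chart[OF U(1)] by blast
  then obtain R where R: "R > 0" "cball (\<phi> (c a)) R \<subseteq> \<phi> ` U"
    using U(2) by (meson imageI open_contains_cball)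
  \<comment> \<open>Halving \<open>R\<close> leaves room for the support of the plateau,
    \<open>cball p (2 * r)\<close>, inside the chart image.\<close>
  define p r where "p = \<phi> (c a)" and "r = R / 2"
  have r: "r > 0" "cball p (2 * r) \<subseteq> \<phi> ` U" "cball p r \<subseteq> \<phi> ` U"
    using R by (auto simp: p_def r_def)
  define g where "g i q = (if q \<in> U then plateau p r (\<phi> q) * (\<phi> q \<bullet> i) else 0)" for i q
  have g: "g i \<in> smooth_functions atlas" for i
    unfolding g_def[abs_def]
    using r plateau_eq_0[OF r(1)]
    by (intro extension_by_zero_smooth[OF U(1) _ compact_cball[of p "2 * r"],
          where h = "\<lambda>y. plateau p r y * (y \<bullet> i)"])
      (auto intro!: C_k_on_mult C_k_on_plateau C_k_on_inner C_k_on_ident C_k_on_const)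
  have "\<exists>L\<ge>0. \<forall>y\<in>cball p r. \<forall>z\<in>cball p r.
      \<bar>X (g i) (inv_into U \<phi> y) - X (g i) (inv_into U \<phi> z)\<bar> \<le> L * norm (y - z)" for i
  proof -
    have "C_k_on 1 (\<phi> ` U) (X (g i) \<circ> inv_into U \<phi>)"
      using X[OF g] U(1) unfolding smooth_functions_def smooth_on_def by blast
    then show ?thesis
      using r(3) by (rule C_k_on_1_imp_lipschitz_cball) auto
  qed
  then obtain L where L: "\<And>i. L i \<ge> 0" "\<And>i y z. y \<in> cball p r \<Longrightarrow> z \<in> cball p r \<Longrightarrow>
      \<bar>X (g i) (inv_into U \<phi> y) - X (g i) (inv_into U \<phi> z)\<bar> \<le> L i * norm (y - z)"
    by metis
  \<comment> \<open>On \<open>W\<close> the plateau is 1, so each \<open>g i\<close> is there the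
    true coordinate \<open>\<phi> q \<bullet> i\<close>.\<close>
  define W where "W = inv_into U \<phi> ` ball p r"
  have W: "open W" "W \<subseteq> U" "c a \<in> W"
    and W_cball: "\<And>q. q \<in> W \<Longrightarrow> \<phi> q \<in> cball p r"
  proof -
    have sub: "ball p r \<subseteq> \<phi> ` U"
      using r(3) ball_subset_cball by blast
    then show "W \<subseteq> U"
      by (auto simp: W_def intro: inv_into_into)
    show "c a \<in> W"
      unfolding W_def p_def using inv_into_f_f[OF chart_inj_on[OF U(1)] U(2)] r(1)
      by (metis centre_in_ball image_eqI)
    show "\<And>q. q \<in> W \<Longrightarrow> \<phi> q \<in> cball p r"
      using sub by (force simp: W_def f_inv_into_f)
    have "homeomorphism (\<phi> ` U) U (inv_into U \<phi>) \<phi>"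
      using chart[OF U(1)] homeomorphism_symD by blast
    moreover have "openin (top_of_set (\<phi> ` U)) (ball p r)"
      using sub open_image by (simp add: openin_open_eq)
    ultimately have "openin (top_of_set U) W"
      unfolding W_def using homeomorphism_imp_open_map by blast
    then show "open W"
      using chart[OF U(1)] openin_open_eq by blast
  qed
  have "\<forall>\<^sub>F t in nhds a. c t \<in> W"
    using integral_curve_continuous[OF c] W
    by (intro topological_tendstoD[where S = W])
      (auto simp: continuous_on_eq_continuous_at continuous_at tendsto_at_iff_tendsto_nhds)
  moreover have "\<forall>\<^sub>F t in nhds a. d t \<in> W"
    using integral_curve_continuous[OF d] W eq
    by (intro topological_tendstoD[where S = W])
      (auto simp: continuous_on_eq_continuous_at continuous_at tendsto_at_iff_tendsto_nhds)
  ultimately have "\<forall>\<^sub>F t in nhds a. c t \<in> W \<and> d t \<in> W"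
    by (rule eventually_conj)
  then obtain e where e: "e > 0" "\<And>t. \<bar>t - a\<bar> < e \<Longrightarrow> c t \<in> W \<and> d t \<in> W"
    by (auto simp: eventually_nhds_metric dist_real_def)
  \<comment> \<open>Built from the globally smooth \<open>g i\<close>, \<open>u\<close> is
    differentiable at every time; while both curves stay in \<open>W\<close> it is the squared
    coordinate distance.\<close>
  define u where "u t = (\<Sum>i\<in>Basis. (g i (c t) - g i (d t))\<^sup>2)" for t
  define u' where "u' t =
      (\<Sum>i\<in>Basis. 2 * (g i (c t) - g i (d t)) * (X (g i) (c t) - X (g i) (d t)))" for t
  have deriv: "(u has_real_derivative u' t) (at t)" for t
    unfolding u_def[abs_def] u'_def
    by (auto intro!: derivative_eq_intros integral_curveD[OF c g] integral_curveD[OF d g] sum.cong)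
  have g_eq: "g i q = \<phi> q \<bullet> i" if "q \<in> W" for i q
    using that W(2) plateau_eq_1[OF r(1) W_cball[OF that]] by (auto simp: g_def)
  have u_eq: "u t = (norm (\<phi> (c t) - \<phi> (d t)))\<^sup>2" if "\<bar>t - a\<bar> < e" for t
    using e(2)[OF that] unfolding u_def power2_norm_eq_inner
    by (subst euclidean_inner) (simp add: g_eq inner_diff_left power2_eq_square)
  \<comment> \<open>Each summand of \<open>u'\<close> is at most \<open>2 * L i\<close> times the
    squared coordinate distance.\<close>
  define M where "M = (\<Sum>i\<in>Basis. 2 * L i)"
  have bound: "\<bar>u' t\<bar> \<le> M * u t" if t: "\<bar>t - a\<bar> < e" for t
  proof -
    let ?n = "norm (\<phi> (c t) - \<phi> (d t))"
    have "\<bar>g i (c t) - g i (d t)\<bar> \<le> ?n" if "i \<in> Basis" for i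
      using e(2)[OF t] Basis_le_norm[OF that, of "\<phi> (c t) - \<phi> (d t)"]
      by (simp add: g_eq inner_diff_left)
    moreover have "\<bar>X (g i) (c t) - X (g i) (d t)\<bar> \<le> L i * ?n" for i
      using L(2)[OF W_cball W_cball, of "c t" "d t" i] e(2)[OF t] W(2)
        inv_into_f_f[OF chart_inj_on[OF U(1)]] by (metis subsetD)
    ultimately have "\<bar>2 * (g i (c t) - g i (d t)) * (X (g i) (c t) - X (g i) (d t))\<bar>
        \<le> 2 * ?n * (L i * ?n)" if "i \<in> Basis" for i
      unfolding abs_mult using that by (intro mult_mono) auto
    then have "\<bar>u' t\<bar> \<le> (\<Sum>i\<in>Basis. 2 * ?n * (L i * ?n))"
      unfolding u'_def by (intro order_trans[OF sum_abs] sum_mono)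
    also have "\<dots> = M * u t"
      by (simp add: M_def u_eq[OF t] sum_distrib_left power2_eq_square mult_ac)
    finally show ?thesis .
  qed
  have "c t = d t" if t: "\<bar>t - a\<bar> < e" for t
  proof -
    have "u t = 0"
      by (rule gronwall_zero[OF e(1) deriv bound _ _ t]) (auto simp: u_def eq intro: sum_nonneg)
    then have "\<phi> (c t) = \<phi> (d t)"
      using u_eq[OF t] by simp
    then show ?thesis
      using chart_inj_on[OF U(1)] e(2)[OF t] W(2) by (meson inj_onD subsetD)
  qed
  then show ?thesis
    using e(1) by (auto simp: eventually_nhds_metric dist_real_def)
qed

section \<open>Global uniqueness and the group law of the flow\<close>

text \<open>The coincidence set contains \<open>a\<close>, is closed because the manifold is
  Hausdorff, and is open by local uniqueness; the real line is connected.\<close>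

lemma integral_curve_unique:
  assumes "\<And>g. g \<in> smooth_functions atlas \<Longrightarrow> X g \<in> smooth_functions atlas"
    and "integral_curve atlas X c" "integral_curve atlas X d" "c a = d a"
  shows "c = d"
proof -
  have "closed {t. c t = d t}"
    using assms integral_curve_continuous by (intro closed_Collect_eq) auto
  moreover have "open {t. c t = d t}"
    using integral_curve_unique_local[OF assms(1-3)]
    by (subst open_subopen) (fastforce simp: eventually_nhds)
  ultimately have "{t. c t = d t} = {} \<or> {t. c t = d t} = UNIV"
    by (simp only: clopen[symmetric])
  with assms(4) show ?thesis
    by auto
qed

lemma integral_curve_shift:
  assumes "integral_curve atlas X c"
  shows "integral_curve atlas X (\<lambda>s. c (s + t))"
  unfolding integral_curve_def
proof (intro allI ballI)
  fix s g assume "g \<in> smooth_functions atlas"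
  with assms have "((\<lambda>s. g (c s)) has_real_derivative X g (c (s + t))) (at (s + t))"
    by (rule integral_curveD)
  then show "((\<lambda>s. g (c (s + t))) has_real_derivative X g (c (s + t))) (at s)"
    by (simp only: DERIV_shift)
qed

text \<open>As functions of \<open>s\<close>, both sides are integral curves of \<open>X\<close>
  through \<open>\<alpha> t x\<close> at time 0.\<close>

lemma global_flow_add:
  assumes X: "\<And>g. g \<in> smooth_functions atlas \<Longrightarrow> X g \<in> smooth_functions atlas"
    and flow: "global_flow atlas X \<alpha>"
  shows "\<alpha> s (\<alpha> t x) = \<alpha> (s + t) x"
proof -
  have "(\<lambda>s. \<alpha> s (\<alpha> t x)) = (\<lambda>s. \<alpha> (s + t) x)"
  proof (rule integral_curve_unique[where X = X and a = 0, OF X])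
    show "integral_curve atlas X (\<lambda>s. \<alpha> s (\<alpha> t x))"
      using flow by (simp add: global_flow_def)
    show "integral_curve atlas X (\<lambda>s. \<alpha> (s + t) x)"
      by (rule integral_curve_shift) (use flow in \<open>simp add: global_flow_def\<close>)
    show "\<alpha> 0 (\<alpha> t x) = \<alpha> (0 + t) x"
      using flow by (simp add: global_flow_def)
  qed
  then show ?thesis
    by (rule fun_cong)
qed

end

section \<open>Complete observables along an orbit\<close>

lemma complete_observable_eq:
  assumes "complete_observable_well_defined \<alpha> f T \<tau> x" "T (\<alpha> t x) = \<tau>"
  shows "complete_observable \<alpha> f T \<tau> x = f (\<alpha> t x)"
  unfolding complete_observable_def
proof (rule the_equality)
  show "\<exists>s. T (\<alpha> s x) = \<tau> \<and> f (\<alpha> t x) = f (\<alpha> s x)"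
    using assms(2) by blast
  show "v = f (\<alpha> t x)" if "\<exists>s. T (\<alpha> s x) = \<tau> \<and> v = f (\<alpha> s x)" for v
    using that assms unfolding complete_observable_well_defined_def by blast
qed

theorem theorem3p1:
  fixes atlas ::
      "('m::{t2_space,second_countable_topology} set \<times> ('m \<Rightarrow> 'e::euclidean_space)) set"
    and bracket :: "('m \<Rightarrow> real) \<Rightarrow> ('m \<Rightarrow> real) \<Rightarrow> ('m \<Rightarrow> real)"
    and C f T :: "'m \<Rightarrow> real"
    and \<alpha> :: "real \<Rightarrow> 'm \<Rightarrow> 'm"
    and x :: 'm
  assumes phase_space: "nondegenerate_poisson_manifold atlas bracket"
    and constraint: "C \<in> smooth_functions atlas"
    and flow: "global_flow atlas (hamiltonian_vector_field bracket C) \<alpha>"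
    and f: "f \<in> smooth_functions atlas"
    and T: "T \<in> smooth_functions atlas"
    and single_valued: "\<And>s t. T (\<alpha> t x) = T (\<alpha> s x) \<Longrightarrow> f (\<alpha> t x) = f (\<alpha> s x)"
  shows "\<forall>\<tau>\<in>range (\<lambda>t. T (\<alpha> t x)). \<forall>\<epsilon>.
           complete_observable_well_defined \<alpha> f T \<tau> (\<alpha> \<epsilon> x) \<and>
           complete_observable \<alpha> f T \<tau> (\<alpha> \<epsilon> x) = complete_observable \<alpha> f T \<tau> x"
proof (intro ballI allI)
  interpret nondegenerate_poisson_manifold atlas bracket
    by (rule phase_space)
  have add: "\<alpha> s (\<alpha> t x) = \<alpha> (s + t) x" for s t
    \<comment> \<open>Bracketing with the smooth \<open>C\<close> preserves smooth functions, as
      uniqueness of integral curves requires of the vector field.\<close>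
    using bracket_smooth[OF constraint]
    by (intro global_flow_add[OF _ flow]) (simp add: hamiltonian_vector_field_def)
  fix \<tau> \<epsilon> assume "\<tau> \<in> range (\<lambda>t. T (\<alpha> t x))"
  then obtain t where t: "T (\<alpha> t x) = \<tau>"
    by auto
  \<comment> \<open>From \<open>\<alpha> \<epsilon> x\<close> the point \<open>\<alpha> t x\<close>
    is reached at time \<open>t - \<epsilon>\<close>; both complete observables are evaluated at
    this common point.\<close>
  then have t': "T (\<alpha> (t - \<epsilon>) (\<alpha> \<epsilon> x)) = \<tau>"
    by (simp add: add)
  have wd: "complete_observable_well_defined \<alpha> f T \<tau> x"
    using t single_valued unfolding complete_observable_well_defined_def by metis
  \<comment> \<open>After rewriting with \<open>add\<close>, the orbit of
    \<open>\<alpha> \<epsilon> x\<close> is that of \<open>x\<close> at shifted times, so the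
    hypothesis at \<open>x\<close> suffices.\<close>
  moreover have wd': "complete_observable_well_defined \<alpha> f T \<tau> (\<alpha> \<epsilon> x)"
    using t' single_valued unfolding complete_observable_well_defined_def add by metis
  ultimately show "complete_observable_well_defined \<alpha> f T \<tau> (\<alpha> \<epsilon> x) \<and>
      complete_observable \<alpha> f T \<tau> (\<alpha> \<epsilon> x) = complete_observable \<alpha> f T \<tau> x"
    using complete_observable_eq[OF wd t] complete_observable_eq[OF wd' t'] by (simp add: add)
qed

end
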